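(* Let $(X,d)$ be a totally bounded metric space and let $T:X\to X$ be an expansive mapping, i.e., $d(Tx,Ty)\ge d(x,y)$ for all $x,y\in X$. Then $T$ has a dense range, i.e., $\overline{T(X)}=X$, and $T$ is an isometry, i.e., $d(Tx,Ty)=d(x,y)$ for all $x,y\in X$.
   Context: A metric space $(X,d)$ is called totally bounded if every sequence of its elements contains a Cauchy subsequence. The bar denotes closure in $(X,d)$. No continuity of $T$ is assumed. *)

theory Defs
  imports "HOL-Analysis.Abstract_Metric_Spaces"
begin

text \<open>
  Total boundedness is taken in its sequential form. This is not the definition of the library's
  \<open>mtotally_bounded\<close> (finite \<open>\<epsilon>\<close>-nets); the two are related by
  \<open>mtotally_bounded_sequentially\<close>.
\<close>

definition totally_bounded_metric_space :: "'a set \<Rightarrow> ('a \<Rightarrow> 'a \<Rightarrow> real) \<Rightarrow> bool" where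
  "totally_bounded_metric_space X d \<longleftrightarrow>
     Metric_space X d \<and>
     (\<forall>\<sigma> :: nat \<Rightarrow> 'a. range \<sigma> \<subseteq> X \<longrightarrow>
        (\<exists>r :: nat \<Rightarrow> nat. strict_mono r \<and> Metric_space.MCauchy X d (\<sigma> \<circ> r)))"

definition expansive_on :: "'a set \<Rightarrow> ('a \<Rightarrow> 'a \<Rightarrow> real) \<Rightarrow> ('a \<Rightarrow> 'a) \<Rightarrow> bool" where
  "expansive_on X d T \<longleftrightarrow> (\<forall>x\<in>X. \<forall>y\<in>X. d (T x) (T y) \<ge> d x y)"

definition isometry_on :: "'a set \<Rightarrow> ('a \<Rightarrow> 'a \<Rightarrow> real) \<Rightarrow> ('a \<Rightarrow> 'a) \<Rightarrow> bool" where
  "isometry_on X d T \<longleftrightarrow> (\<forall>x\<in>X. \<forall>y\<in>X. d (T x) (T y) = d x y)"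

end

theory Submission
  imports Defs
begin

text \<open>
  Two Cauchy orbit subsequences along common indices, pulled back by expansiveness, show that any
  two points return simultaneously within \<open>\<epsilon>\<close> of themselves under some \<open>T\<^sup>k\<close> with \<open>k > 0\<close>. Hence
  \<open>T\<^sup>k x\<close>, a point of the range, approximates \<open>x\<close>, and
  \<open>d(Tx, Ty) \<le> d(T\<^sup>k x, T\<^sup>k y) < d(x, y) + 2\<epsilon>\<close>.
\<close>

lemma funpow_mem:
  assumes "f \<in> A \<rightarrow> A" "x \<in> A"
  shows "(f ^^ n) x \<in> A"
  using assms by (induction n) auto

lemma expansive_on_funpow:
  assumes "T \<in> X \<rightarrow> X" "expansive_on X d T" "x \<in> X" "y \<in> X"
  shows "d x y \<le> d ((T ^^ n) x) ((T ^^ n) y)"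
proof (induction n)
  case (Suc n)
  have "(T ^^ n) x \<in> X" "(T ^^ n) y \<in> X"
    using funpow_mem[OF assms(1)] assms(3,4) by simp_all
  with Suc assms(2) show ?case
    unfolding expansive_on_def by fastforce
qed simp

text \<open>One \<open>k\<close> has to serve both points, since the isometry estimate moves
  \<open>x\<close> and \<open>y\<close> by the same iterate. Density concerns a single point and
  takes \<open>y = x\<close>.\<close>

lemma expansive_on_simultaneous_recurrence:
  assumes tb: "totally_bounded_metric_space X d" and T: "T \<in> X \<rightarrow> X" "expansive_on X d T"
    and xy: "x \<in> X" "y \<in> X" and "0 < \<epsilon>"
  obtains k where "0 < k" "d x ((T ^^ k) x) < \<epsilon>" "d y ((T ^^ k) y) < \<epsilon>"
proof -
  interpret Metric_space X d
    using tb by (simp add: totally_bounded_metric_space_def)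
  have orbit: "(T ^^ n) z \<in> X" if "z \<in> X" for n z
    using T(1) that by (rule funpow_mem)
  have subseq: "\<exists>r :: nat \<Rightarrow> nat. strict_mono r \<and> MCauchy (\<sigma> \<circ> r)"
    if "range \<sigma> \<subseteq> X" for \<sigma> :: "nat \<Rightarrow> 'a"
    using tb that by (simp add: totally_bounded_metric_space_def)
  obtain r where r: "strict_mono r" "MCauchy ((\<lambda>n. (T ^^ n) x) \<circ> r)"
    using subseq[of "\<lambda>n. (T ^^ n) x"] orbit[OF xy(1)] by auto
  \<comment> \<open>This extraction starts from the \<open>y\<close>-orbit already thinned by
    \<open>r\<close>. The \<open>x\<close>-orbit stays Cauchy under further thinning, so
    \<open>r \<circ> s\<close> works for both.\<close>
  obtain s where s: "strict_mono s" "MCauchy ((\<lambda>n. (T ^^ r n) y) \<circ> s)"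
    using subseq[of "\<lambda>n. (T ^^ r n) y"] orbit[OF xy(2)] by auto
  have "MCauchy ((\<lambda>n. (T ^^ n) x) \<circ> r \<circ> s)"
    by (rule MCauchy_subsequence[OF s(1) r(2)])
  then obtain M where M: "\<And>n n'. \<lbrakk>M \<le> n; M \<le> n'\<rbrakk> \<Longrightarrow> d ((T ^^ r (s n)) x) ((T ^^ r (s n')) x) < \<epsilon>"
    using \<open>0 < \<epsilon>\<close> unfolding MCauchy_def comp_apply by meson
  obtain N where N: "\<And>n n'. \<lbrakk>N \<le> n; N \<le> n'\<rbrakk> \<Longrightarrow> d ((T ^^ r (s n)) y) ((T ^^ r (s n')) y) < \<epsilon>"
    using s(2) \<open>0 < \<epsilon>\<close> unfolding MCauchy_def comp_apply by meson
  \<comment> \<open>Past both thresholds the neighbouring indices \<open>n\<close> and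
    \<open>Suc n\<close> suffice; strict monotonicity of \<open>r\<close> and \<open>s\<close> makes
    their gap \<open>k\<close> positive.\<close>
  define n where "n = max M N"
  have n: "M \<le> n" "M \<le> Suc n" "N \<le> n" "N \<le> Suc n"
    by (auto simp: n_def)
  define k where "k = r (s (Suc n)) - r (s n)"
  have lt: "r (s n) < r (s (Suc n))"
    using r s by (simp add: strict_mono_less)
  \<comment> \<open>The iterate \<open>T ^^ r (s n)\<close> is expansive and sends \<open>z\<close>
    and \<open>(T ^^ k) z\<close> to two terms of the extracted orbit, so their distance bounds the
    original one.\<close>
  have pullback: "d z ((T ^^ k) z) \<le> d ((T ^^ r (s n)) z) ((T ^^ r (s (Suc n))) z)" if "z \<in> X" for z
  proof -
    have "(T ^^ r (s (Suc n))) z = (T ^^ r (s n)) ((T ^^ k) z)"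
      using lt funpow_add[of "r (s n)" k T] by (simp add: k_def)
    then show ?thesis
      using expansive_on_funpow[OF T that orbit[OF that]] by simp
  qed
  show thesis
  proof
    show "0 < k" using lt by (simp add: k_def)
    show "d x ((T ^^ k) x) < \<epsilon>"
      using pullback[OF xy(1)] M[OF n(1,2)] by linarith
    show "d y ((T ^^ k) y) < \<epsilon>"
      using pullback[OF xy(2)] N[OF n(3,4)] by linarith
  qed
qed

theorem theorem5p1:
  fixes X :: "'a set" and d :: "'a \<Rightarrow> 'a \<Rightarrow> real" and T :: "'a \<Rightarrow> 'a"
  assumes "totally_bounded_metric_space X d"
    and "T \<in> X \<rightarrow> X"
    and "expansive_on X d T"
  shows "(Metric_space.mtopology X d) closure_of (T ` X) = X \<and> isometry_on X d T"
proof
  interpret Metric_space X d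
    using assms(1) by (simp add: totally_bounded_metric_space_def)
  have orbit: "(T ^^ n) z \<in> X" if "z \<in> X" for n z
    using assms(2) that by (rule funpow_mem)
  have "\<exists>y\<in>T ` X. y \<in> mball x \<epsilon>" if "x \<in> X" "0 < \<epsilon>" for x \<epsilon>
  proof -
    obtain k where k: "0 < k" "d x ((T ^^ k) x) < \<epsilon>"
      using expansive_on_simultaneous_recurrence[OF assms \<open>x \<in> X\<close> \<open>x \<in> X\<close> \<open>0 < \<epsilon>\<close>] by blast
    \<comment> \<open>Positivity of \<open>k\<close> matters here: with a factor \<open>T\<close>
      split off, the nearby point is the image of \<open>(T ^^ j) x\<close>.\<close>
    then obtain j where "k = Suc j"
      using gr0_implies_Suc by blast
    then have "(T ^^ k) x \<in> T ` X"
      using orbit[OF \<open>x \<in> X\<close>] by simp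
    then show ?thesis
      using k orbit[OF \<open>x \<in> X\<close>] \<open>x \<in> X\<close> by (intro bexI[of _ "(T ^^ k) x"]) simp_all
  qed
  then show "mtopology closure_of (T ` X) = X"
    by (auto simp: metric_closure_of)
  show "isometry_on X d T"
    unfolding isometry_on_def
  proof (intro ballI antisym)
    fix x y assume xy: "x \<in> X" "y \<in> X"
    show "d x y \<le> d (T x) (T y)"
      using assms(3) xy by (simp add: expansive_on_def)
    show "d (T x) (T y) \<le> d x y"
    proof (rule field_le_epsilon)
      fix e :: real assume "0 < e"
      then obtain k where k: "0 < k" "d x ((T ^^ k) x) < e / 2" "d y ((T ^^ k) y) < e / 2"
        using expansive_on_simultaneous_recurrence[OF assms xy, of "e / 2"] by auto
      obtain j where j: "k = Suc j"
        using k(1) gr0_implies_Suc by blast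
      have "T x \<in> X" "T y \<in> X"
        using assms(2) xy by auto
      \<comment> \<open>\<open>T ^^ k\<close> is \<open>T\<close> followed by the expansive iterate
        \<open>T ^^ j\<close>, so the distance between \<open>T x\<close> and \<open>T y\<close>
        cannot shrink on the way to the return time.\<close>
      then have "d (T x) (T y) \<le> d ((T ^^ k) x) ((T ^^ k) y)"
        using expansive_on_funpow[OF assms(2,3), of "T x" "T y" j] by (simp add: j funpow_swap1)
      also have "\<dots> \<le> d ((T ^^ k) x) x + d x y + d y ((T ^^ k) y)"
        using triangle[of "(T ^^ k) x" x "(T ^^ k) y"] triangle[of x y "(T ^^ k) y"] xy orbit
        by simp
      finally show "d (T x) (T y) \<le> d x y + e"
        using k commute[of x "(T ^^ k) x"] by simp
    qed
  qed
qed

end
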